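(* Let $D\subset\mathbb{R}^2$ be an open set and let $f:D\to\mathbb{R}$ and $g:D\to\mathbb{R}$ be twice continuously differentiable. Let $x^*\in D$ be a critical point for the problem of minimizing $f(x)$ subject to $g(x)=0$, and let $\lambda^*\in\mathbb{R}$ be the corresponding Lagrange multiplier, i.e. $\nabla f(x^* )+\lambda^*\nabla g(x^* )=0$ and $g(x^* )=0$. Define $H=\nabla^2 f(x^* )+\lambda^*\nabla^2 g(x^* )\in\mathbb{R}^{2\times 2}$, assume that $\nabla g(x^* )\neq 0$, and take a nonzero vector $v\in\mathbb{R}^2$ with $v\perp\nabla g(x^* )$. If $v^T H v>0$, then $x^*$ is a local minimizer for the problem.
   Context: The problem is: minimize $f(x)$ subject to $g(x)=0$, with feasible set $\Omega=\{x\in D\mid g(x)=0\}$. A point $x^*\in\Omega$ is a local minimizer of the problem if there exists $\delta>0$ such that $f(x^* )\leq f(x)$ for all $x\in\Omega\cap B(x^*,\delta)$, where $B(x^*,\delta)$ is the Euclidean ball of center $x^*$ and radius $\delta$. Here $\nabla$ denotes the gradient (a column vector), $\nabla^2$ the Hessian matrix, and $\perp$ orthogonality with respect to the standard inner product. *)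

theory Defs
  imports "HOL-Analysis.Analysis"
begin

definition gradient :: "(real ^ 'n \<Rightarrow> real) \<Rightarrow> real ^ 'n \<Rightarrow> real ^ 'n" where
  "gradient f x = (\<chi> i. frechet_derivative f (at x) (axis i 1))"

lemma gderiv_gradient:
  assumes "f differentiable (at x)"
  shows "GDERIV f x :> gradient f x"
proof -
  have D: "(f has_derivative frechet_derivative f (at x)) (at x)"
    using assms by (simp add: frechet_derivative_works)
  then have lin: "linear (frechet_derivative f (at x))"
    by (rule has_derivative_linear)
  have "frechet_derivative f (at x) h = h \<bullet> gradient f x" for h
  proof -
    have "frechet_derivative f (at x) h
        = frechet_derivative f (at x) (\<Sum>i\<in>UNIV. h $ i *\<^sub>R axis i 1)"
      by (simp add: basis_expansion scalar_mult_eq_scaleR[symmetric])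
    also have "\<dots> = (\<Sum>i\<in>UNIV. h $ i *\<^sub>R frechet_derivative f (at x) (axis i 1))"
      by (simp add: linear_sum[OF lin] linear_cmul[OF lin])
    also have "\<dots> = h \<bullet> gradient f x"
      by (simp add: gradient_def inner_vec_def)
    finally show ?thesis .
  qed
  then have "frechet_derivative f (at x) = (\<lambda>h. h \<bullet> gradient f x)"
    by blast
  then show ?thesis
    using D by (simp add: gderiv_def)
qed

(* Entry (i, j) is the j-th partial derivative of the i-th partial derivative of f. *)
definition hessian :: "(real ^ 'n \<Rightarrow> real) \<Rightarrow> real ^ 'n \<Rightarrow> real ^ 'n ^ 'n" where
  "hessian f x = jacobian (gradient f) (at x)"

(* Intended for open D; then the values of f outside D are irrelevant. *)
definition twice_continuously_differentiable_on ::
    "(real ^ 'n \<Rightarrow> real) \<Rightarrow> (real ^ 'n) set \<Rightarrow> bool" where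
  "twice_continuously_differentiable_on f D \<longleftrightarrow>
     (\<forall>x\<in>D. f differentiable (at x)) \<and>
     (\<forall>x\<in>D. gradient f differentiable (at x)) \<and>
     continuous_on D (hessian f)"

definition feasible_set :: "('a \<Rightarrow> real) \<Rightarrow> 'a set \<Rightarrow> 'a set" where
  "feasible_set g D = {x \<in> D. g x = 0}"

definition local_minimizer ::
    "('a::metric_space \<Rightarrow> real) \<Rightarrow> 'a set \<Rightarrow> 'a \<Rightarrow> bool" where
  "local_minimizer f \<Omega> x \<longleftrightarrow>
     x \<in> \<Omega> \<and> (\<exists>\<delta>>0. \<forall>y \<in> \<Omega> \<inter> ball x \<delta>. f x \<le> f y)"

end

theory Submission
  imports Defs
begin

text \<open>
  On the feasible set, \<open>f\<close> coincides with the Lagrangian \<open>f + l g\<close>, whose gradient vanishes at the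
  critical point. If there were feasible points \<open>y k\<close> tending to the critical point with smaller
  values, the normalised directions would accumulate at a unit vector \<open>u\<close>. The first-order expansion
  of \<open>g\<close> makes \<open>u\<close> orthogonal to the gradient of \<open>g\<close>, and the second-order expansion of the
  Lagrangian gives \<open>u \<bullet> H u \<le> 0\<close>. In the plane such a \<open>u\<close> is a multiple of \<open>v\<close>.
\<close>

text \<open>
  The mean value theorem is applied to the remainder along the segment from \<open>x\<close> to \<open>y\<close>. Only
  differentiability of \<open>G\<close> at the single point \<open>x\<close> is needed, and symmetry of \<open>A\<close> is not.
\<close>

lemma second_order_taylor_tendsto:
  fixes F :: "'a::real_inner \<Rightarrow> real"
  assumes F: "\<forall>\<^sub>F y in nhds x. GDERIV F y :> G y"
    and G: "(G has_derivative A) (at x)"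
  shows "((\<lambda>y. (F y - F x - (y - x) \<bullet> G x - ((y - x) \<bullet> A (y - x)) / 2) / (norm (y - x))\<^sup>2) \<longlongrightarrow> 0) (at x)"
proof (rule tendstoI)
  fix e :: real
  assume e: "e > 0"
  obtain d1 where d1: "d1 > 0" "\<And>y. dist y x < d1 \<Longrightarrow> GDERIV F y :> G y"
    using F unfolding eventually_nhds_metric by blast
  obtain d2 where d2: "d2 > 0"
    "\<And>y. norm (y - x) < d2 \<Longrightarrow> norm (G y - G x - A (y - x)) \<le> e / 2 * norm (y - x)"
    using G e unfolding has_derivative_at_alt by (meson half_gt_zero)
  have lin: "linear A"
    using G by (rule has_derivative_linear)
  have "\<bar>(F y - F x - (y - x) \<bullet> G x - ((y - x) \<bullet> A (y - x)) / 2) / (norm (y - x))\<^sup>2\<bar> < e"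
    if y: "y \<noteq> x" "dist y x < min d1 d2" for y
  proof -
    define h where "h = y - x"
    have h: "norm h > 0" "norm h < d1" "norm h < d2"
      using y by (auto simp: h_def dist_norm)
    \<comment> \<open>\<open>\<psi>\<close> is the Taylor remainder along the segment, so
      \<open>\<psi> 1 - \<psi> 0\<close> is the numerator of the quotient. Its derivative is the
      inner product of \<open>h\<close> with the first-order error of \<open>G\<close>.\<close>
    define \<psi> where "\<psi> = (\<lambda>t. F (x + t *\<^sub>R h) - t * (h \<bullet> G x) - t\<^sup>2 / 2 * (h \<bullet> A h))"
    have le: "norm (t *\<^sub>R h) \<le> norm h" if "0 \<le> t" "t \<le> 1" for t :: real
      using that by (simp add: mult_left_le_one_le)
    have deriv: "(\<psi> has_real_derivative h \<bullet> (G (x + t *\<^sub>R h) - G x - A (t *\<^sub>R h))) (at t)"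
      if t: "0 \<le> t" "t \<le> 1" for t
    proof -
      have "dist (x + t *\<^sub>R h) x < d1"
        using le_less_trans[OF le[OF t] h(2)] by (simp add: dist_norm)
      then have FD: "(F has_derivative (\<lambda>k. k \<bullet> G (x + t *\<^sub>R h))) (at (x + t *\<^sub>R h))"
        using d1(2) unfolding gderiv_def by blast
      have "((\<lambda>t. x + t *\<^sub>R h) has_derivative (\<lambda>s. s *\<^sub>R h)) (at t)"
        by (auto intro!: derivative_eq_intros)
      from diff_chain_at[OF this FD]
      have [derivative_intros]: "((\<lambda>t. F (x + t *\<^sub>R h)) has_real_derivative h \<bullet> G (x + t *\<^sub>R h)) (at t)"
        by (simp add: has_field_derivative_def o_def mult_commute_abs)
      show ?thesis
        unfolding \<psi>_def
        by (auto intro!: derivative_eq_intros simp: inner_diff_right inner_add_right linear_cmul[OF lin] field_simps)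
    qed
    obtain s where s: "0 < s" "s < 1"
      "\<psi> 1 - \<psi> 0 = (1 - 0) * (h \<bullet> (G (x + s *\<^sub>R h) - G x - A (s *\<^sub>R h)))"
      using MVT2[of 0 1 \<psi> "\<lambda>t. h \<bullet> (G (x + t *\<^sub>R h) - G x - A (t *\<^sub>R h))"] deriv
      by fastforce
    \<comment> \<open>The error of \<open>G\<close> contributes one factor \<open>norm h\<close>,
      and Cauchy-Schwarz contributes the other. Having \<open>e / 2\<close> here leaves room for the
      strict bound by \<open>e\<close>.\<close>
    have "norm (G (x + s *\<^sub>R h) - G x - A (s *\<^sub>R h)) \<le> e / 2 * norm (s *\<^sub>R h)"
      using d2(2)[of "x + s *\<^sub>R h"] le_less_trans[OF le[of s] h(3)] s by simp
    also have "\<dots> \<le> e / 2 * norm h"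
      using le[of s] s e by (intro mult_left_mono) auto
    finally have "norm h * norm (G (x + s *\<^sub>R h) - G x - A (s *\<^sub>R h)) \<le> norm h * (e / 2 * norm h)"
      by (intro mult_left_mono) auto
    moreover have "\<bar>\<psi> 1 - \<psi> 0\<bar> \<le> norm h * norm (G (x + s *\<^sub>R h) - G x - A (s *\<^sub>R h))"
      using s(3) Cauchy_Schwarz_ineq2 by simp
    ultimately have "\<bar>\<psi> 1 - \<psi> 0\<bar> \<le> e / 2 * (norm h)\<^sup>2"
      by (simp add: power2_eq_square mult_ac)
    also have "\<dots> < e * (norm h)\<^sup>2"
      using e h by simp
    finally have "\<bar>\<psi> 1 - \<psi> 0\<bar> / (norm h)\<^sup>2 < e"
      using h by (simp add: divide_less_eq)
    moreover have "\<psi> 1 - \<psi> 0 = F y - F x - h \<bullet> G x - (h \<bullet> A h) / 2"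
      by (simp add: \<psi>_def h_def)
    ultimately show ?thesis
      by (simp add: h_def abs_divide)
  qed
  then show "\<forall>\<^sub>F y in at x. dist ((F y - F x - (y - x) \<bullet> G x - ((y - x) \<bullet> A (y - x)) / 2) / (norm (y - x))\<^sup>2) 0 < e"
    unfolding eventually_at using d1(1) d2(1)
    by (intro exI[of _ "min d1 d2"]) (auto simp: dist_real_def)
qed

text \<open>Intended for the Lagrangian: since its whole gradient vanishes at \<open>x\<close>, the
  quadratic term decides, and the constraint leaves only limiting directions orthogonal to
  \<open>n\<close>. Such a direction exists because the unit sphere is compact in finite
  dimension.\<close>

lemma constrained_second_order_sufficient:
  fixes F g :: "'a::euclidean_space \<Rightarrow> real"
  assumes F: "\<forall>\<^sub>F y in nhds x. GDERIV F y :> G y"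
    and G: "(G has_derivative A) (at x)"
    and crit: "G x = 0"
    and g: "GDERIV g x :> n"
    and pos: "\<And>u. u \<noteq> 0 \<Longrightarrow> u \<bullet> n = 0 \<Longrightarrow> u \<bullet> A u > 0"
  shows "\<exists>\<delta>>0. \<forall>y\<in>ball x \<delta>. g y = g x \<longrightarrow> F x \<le> F y"
proof (rule ccontr)
  assume contra: "\<not> ?thesis"
  have "\<exists>y. dist x y < inverse (Suc k) \<and> g y = g x \<and> F y < F x" for k
  proof -
    have "inverse (real (Suc k)) > 0" by simp
    then show ?thesis
      using contra by (meson mem_ball not_le)
  qed
  then obtain y where y: "dist x (y k) < inverse (Suc k)" "g (y k) = g x" "F (y k) < F x" for k
    by metis
  have ne: "y k \<noteq> x" for k
    using y(3)[of k] by auto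
  have "y \<longlonglongrightarrow> x"
  proof (rule metric_tendsto_imp_tendsto[OF LIMSEQ_inverse_real_of_nat])
    show "\<forall>\<^sub>F k in sequentially. dist (y k) x \<le> dist (inverse (real (Suc k))) 0"
      using y(1) by (auto simp: dist_commute less_imp_le intro!: always_eventually)
  qed
  define u where "u k = sgn (y k - x)" for k
  have "\<forall>k. u k \<in> sphere 0 1"
    using ne by (simp add: u_def norm_sgn)
  then obtain w r where w: "w \<in> sphere 0 1" "strict_mono r" "(u \<circ> r) \<longlonglongrightarrow> w"
    using compact_sphere[of 0 1] unfolding compact_def by blast
  have lim: "filterlim (y \<circ> r) (at x) sequentially"
    using LIMSEQ_subseq_LIMSEQ[OF \<open>y \<longlonglongrightarrow> x\<close> w(2)] ne
    by (auto simp: filterlim_at intro!: always_eventually)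
  \<comment> \<open>As \<open>g (y k) = g x\<close>, the normalised first-order remainder of
    \<open>g\<close> at \<open>y k\<close> is exactly
    \<open>\<bar>u k \<bullet> n\<bar>\<close>.\<close>
  have "(\<lambda>k. \<bar>u (r k) \<bullet> n\<bar>) \<longlonglongrightarrow> 0"
  proof -
    have "((\<lambda>z. norm (g z - g x - (z - x) \<bullet> n) / norm (z - x)) \<longlongrightarrow> 0) (at x)"
      using g unfolding gderiv_def has_derivative_iff_norm by blast
    from filterlim_compose[OF this lim] show ?thesis
      by (simp add: y(2) u_def sgn_div_norm abs_mult divide_inverse mult.commute)
  qed
  moreover have "(\<lambda>k. \<bar>u (r k) \<bullet> n\<bar>) \<longlonglongrightarrow> \<bar>w \<bullet> n\<bar>"
    using w(3) unfolding o_def by (intro tendsto_intros)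
  ultimately have "w \<bullet> n = 0"
    using LIMSEQ_unique by fastforce
  then have "w \<bullet> A w > 0"
    using pos[of w] w(1) by (cases "w = 0") auto
  have lin: "bounded_linear A"
    using G by (rule has_derivative_bounded_linear)
  define R where
    "R z = (F z - F x - (z - x) \<bullet> G x - ((z - x) \<bullet> A (z - x)) / 2) / (norm (z - x))\<^sup>2" for z
  have "(\<lambda>k. R (y (r k))) \<longlonglongrightarrow> 0"
    using filterlim_compose[OF second_order_taylor_tendsto[OF F G] lim]
    by (simp add: R_def o_def)
  moreover have "(\<lambda>k. u (r k) \<bullet> A (u (r k))) \<longlonglongrightarrow> w \<bullet> A w"
    using w(3) unfolding o_def by (intro tendsto_intros bounded_linear.tendsto[OF lin])
  ultimately have "(\<lambda>k. R (y (r k)) + u (r k) \<bullet> A (u (r k)) / 2) \<longlonglongrightarrow> 0 + w \<bullet> A w / 2"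
    by (intro tendsto_add tendsto_divide tendsto_const) auto
  \<comment> \<open>The linear term drops out because \<open>G x = 0\<close>, and the quadratic form
    is homogeneous of degree two. What remains is a quotient made nonpositive by the choice of
    \<open>y k\<close>.\<close>
  moreover have "R (y k) + u k \<bullet> A (u k) / 2 = (F (y k) - F x) / (norm (y k - x))\<^sup>2" for k
  proof -
    have "u k \<bullet> A (u k) = (y k - x) \<bullet> A (y k - x) / (norm (y k - x))\<^sup>2"
      by (simp add: u_def sgn_div_norm linear_cmul[OF bounded_linear.linear[OF lin]]
          power2_eq_square divide_inverse mult_ac)
    then show ?thesis
      by (simp add: R_def crit diff_divide_distrib)
  qed
  moreover have "(F (y k) - F x) / (norm (y k - x))\<^sup>2 \<le> 0" for k
    using y(3)[of k] by (intro divide_nonpos_nonneg) auto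
  ultimately have "0 + w \<bullet> A w / 2 \<le> 0"
    by (intro LIMSEQ_le_const2) auto
  with \<open>w \<bullet> A w > 0\<close> show False by simp
qed

text \<open>The matrix with rows \<open>u\<close> and \<open>v\<close> annihilates the nonzero
  vector \<open>n\<close>, so its determinant is zero.\<close>

lemma orthogonal_same_vec2_imp_parallel:
  fixes u v n :: "real ^ 2"
  assumes "n \<noteq> 0" "v \<noteq> 0" "orthogonal u n" "orthogonal v n"
  obtains t where "u = t *\<^sub>R v"
proof -
  have un: "u $ 1 * n $ 1 + u $ 2 * n $ 2 = 0" and vn: "v $ 1 * n $ 1 + v $ 2 * n $ 2 = 0"
    using assms(3,4) by (auto simp: orthogonal_def inner_vec_def sum_2)
  have "(u $ 1 * v $ 2 - u $ 2 * v $ 1) * n $ 1 = 0" "(u $ 1 * v $ 2 - u $ 2 * v $ 1) * n $ 2 = 0"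
    using un vn by algebra+
  then have det: "u $ 1 * v $ 2 = u $ 2 * v $ 1"
    using \<open>n \<noteq> 0\<close> by (auto simp: vec_eq_iff forall_2)
  \<comment> \<open>The scalar \<open>t\<close> is the coefficient of the projection of
    \<open>u\<close> onto \<open>v\<close>. In each coordinate the two sides differ by a multiple of
    the determinant.\<close>
  have "(v \<bullet> v) *\<^sub>R u = (u \<bullet> v) *\<^sub>R v"
    using det by (simp add: vec_eq_iff forall_2 inner_vec_def sum_2) algebra
  then have "u = ((u \<bullet> v) / (v \<bullet> v)) *\<^sub>R v"
    using \<open>v \<noteq> 0\<close> by (simp add: eq_vector_fraction_iff)
  then show thesis by (rule that)
qed

theorem theorem4p2:
  fixes D :: "(real ^ 2) set"
    and f g :: "real ^ 2 \<Rightarrow> real"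
    and xs v :: "real ^ 2"
    and l :: real
    and H :: "real ^ 2 ^ 2"
  assumes "open D"
    and "twice_continuously_differentiable_on f D"
    and "twice_continuously_differentiable_on g D"
    and "xs \<in> D"
    and "gradient f xs + l *\<^sub>R gradient g xs = 0"
    and "g xs = 0"
    and "H = hessian f xs + l *\<^sub>R hessian g xs"
    and "gradient g xs \<noteq> 0"
    and "v \<noteq> 0"
    and "orthogonal v (gradient g xs)"
    and "v \<bullet> (H *v v) > 0"
  shows "local_minimizer f (feasible_set g D) xs"
proof -
  \<comment> \<open>\<open>F\<close> is the Lagrangian with fixed multiplier \<open>l\<close>; its
    gradient \<open>G\<close> vanishes at \<open>xs\<close> and has derivative \<open>H\<close>
    there.\<close>
  define F where "F y = f y + l * g y" for y
  define G where "G y = gradient f y + l *\<^sub>R gradient g y" for y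
  have gderivs: "GDERIV f y :> gradient f y" "GDERIV g y :> gradient g y" if "y \<in> D" for y
    using that assms(2,3) gderiv_gradient
    unfolding twice_continuously_differentiable_on_def by blast+
  have "GDERIV F y :> G y" if "y \<in> D" for y
    using gderivs[OF that] unfolding gderiv_def F_def G_def
    by (auto intro!: derivative_eq_intros simp: inner_add_right)
  then have F: "\<forall>\<^sub>F y in nhds xs. GDERIV F y :> G y"
    using eventually_nhds_in_open[OF assms(1,4)] by (auto elim: eventually_mono)
  have hess: "(gradient f has_derivative (\<lambda>h. hessian f xs *v h)) (at xs)"
    "(gradient g has_derivative (\<lambda>h. hessian g xs *v h)) (at xs)"
    using assms(2-4) jacobian_works
    unfolding twice_continuously_differentiable_on_def hessian_def by blast+
  have "(l *\<^sub>R M) *v h = l *\<^sub>R (M *v h)" for M :: "real ^ 2 ^ 2" and h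
    by (simp add: scaleR_matrix_vector_assoc)
  then have G: "(G has_derivative (\<lambda>h. H *v h)) (at xs)"
    unfolding G_def assms(7)
    by (auto intro!: derivative_eq_intros hess simp: matrix_vector_mult_add_rdistrib)
  \<comment> \<open>Orthogonality leaves only the line through \<open>v\<close>, on which the
    quadratic form is scaled by \<open>t\<^sup>2 > 0\<close>.\<close>
  have pos: "u \<bullet> (H *v u) > 0" if "u \<noteq> 0" "u \<bullet> gradient g xs = 0" for u
  proof -
    have "orthogonal u (gradient g xs)"
      using that by (simp add: orthogonal_def)
    then obtain t where t: "u = t *\<^sub>R v"
      using orthogonal_same_vec2_imp_parallel assms(8-10) by blast
    then have "u \<bullet> (H *v u) = t\<^sup>2 * (v \<bullet> (H *v v))"
      by (simp add: matrix_vector_mult_scaleR power2_eq_square)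
    moreover have "t \<noteq> 0"
      using t that by auto
    ultimately show ?thesis
      using assms(11) by simp
  qed
  \<comment> \<open>Since \<open>g xs = 0\<close>, every feasible point lies on the level set of
    \<open>g\<close> through \<open>xs\<close>, and \<open>F\<close> equals \<open>f\<close>
    there.\<close>
  obtain \<delta> where "\<delta> > 0" "\<And>y. y \<in> ball xs \<delta> \<Longrightarrow> g y = g xs \<Longrightarrow> F xs \<le> F y"
    using constrained_second_order_sufficient[OF F G _ gderivs(2)[OF assms(4)] pos] assms(5)
    unfolding G_def by blast
  then show ?thesis
    using assms(4,6) unfolding local_minimizer_def feasible_set_def F_def by force
qed

end
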